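(* Fix $\alpha\in(0,1)$, an integer $n\geq 1$, a model class $\mathcal{F}$, and a probability distribution $P$ on $\mathcal{Z}$. Let $\hat{L}_\alpha^{\mathrm{ERM}}(\mathcal{F},\mathcal{D}_n) := \alpha\cdot \hat{R}(\mathcal{F},\mathcal{D}_n)$. Suppose $N_+(\mathcal{F},P)<n$. Then $$\mathbb{P}_P\left\{\hat{L}_\alpha^{\mathrm{ERM}}(\mathcal{F},\mathcal{D}_n)>0\right\}=1.$$
   Context: Let $\mathcal{Z}$ be the (measurable) data space, $\mathcal{F}$ a set of models (the model class), and $\ell:\mathcal{F}\times\mathcal{Z}\to[0,\infty)$ a loss function. For a data set $\mathcal{D}_n=(Z_1,\dots,Z_n)\in\mathcal{Z}^n$, the empirical risk is $\hat{R}(f,\mathcal{D}_n)=\frac1n\sum_{i=1}^n\ell(f,Z_i)$ and $\hat{R}(\mathcal{F},\mathcal{D}_n)=\inf_{f\in\mathcal{F}}\hat{R}(f,\mathcal{D}_n)$. $\mathbb{P}_P$ denotes probability when $\mathcal{D}_n\sim P^n$ (i.i.d. draws from $P$). Define $N_+(\mathcal{F},P)=\sup\{k:\ \mathbb{P}_P\{\hat{R}(\mathcal{F},\mathcal{D}_k)=0\}>0\}$, the supremum being over sample sizes $k\ge 1$, with $\mathcal{D}_k\sim P^k$ (the supremum of the empty set is $0$; the value $\infty$ is allowed). All functions, infima and events involved are implicitly assumed measurable so that expectations and probabilities are defined. *)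

theory Defs
  imports "HOL-Probability.Probability"
begin

text \<open>
  A data set of size \<open>n\<close> is a function on the index set \<open>{1..n}\<close>, and the law
  \<open>P\<^sup>n\<close> of \<open>n\<close> independent draws from \<open>P\<close> is the product measure over that index set.
\<close>

definition iid_sample :: "'z measure \<Rightarrow> nat \<Rightarrow> (nat \<Rightarrow> 'z) measure"
  where "iid_sample P n = (\<Pi>\<^sub>M i\<in>{1..n}. P)"

definition emp_risk :: "('f \<Rightarrow> 'z \<Rightarrow> real) \<Rightarrow> nat \<Rightarrow> 'f \<Rightarrow> (nat \<Rightarrow> 'z) \<Rightarrow> real"
  where "emp_risk l n f D = (1 / real n) * (\<Sum>i=1..n. l f (D i))"

text \<open>
  The infimum is taken in the extended reals, so that it is \<open>\<infinity>\<close> for an empty model class;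
  for a nonempty class and a nonnegative loss it is the usual real infimum.
\<close>

definition min_emp_risk :: "('f \<Rightarrow> 'z \<Rightarrow> real) \<Rightarrow> nat \<Rightarrow> 'f set \<Rightarrow> (nat \<Rightarrow> 'z) \<Rightarrow> ereal"
  where "min_emp_risk l n F D = (INF f\<in>F. ereal (emp_risk l n f D))"

text \<open>The supremum in \<^typ>\<open>enat\<close> of the empty set is \<open>0\<close>, that of an unbounded set is \<open>\<infinity>\<close>.\<close>

definition N_plus :: "('f \<Rightarrow> 'z \<Rightarrow> real) \<Rightarrow> 'f set \<Rightarrow> 'z measure \<Rightarrow> enat"
  where "N_plus l F P =
    (SUP k\<in>{k. k \<ge> 1 \<and>
       measure (iid_sample P k) {D \<in> space (iid_sample P k). min_emp_risk l k F D = 0} > 0}. enat k)"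

definition L_ERM :: "real \<Rightarrow> ('f \<Rightarrow> 'z \<Rightarrow> real) \<Rightarrow> nat \<Rightarrow> 'f set \<Rightarrow> (nat \<Rightarrow> 'z) \<Rightarrow> ereal"
  where "L_ERM \<alpha> l n F D = ereal \<alpha> * min_emp_risk l n F D"

end

theory Submission imports Defs begin

text \<open>
  Having a minimal empirical risk of \<open>0\<close> with positive probability at sample size \<open>n\<close> would
  make \<open>n\<close> one of the sample sizes over which \<open>N_plus\<close> is the supremum, so \<open>N_plus l F P < n\<close>
  makes that event null.  Since losses are nonnegative, the minimal empirical risk is then
  almost surely strictly positive, and multiplying by \<open>\<alpha> > 0\<close> does not change its sign.
\<close>

lemma prob_space_iid_sample: "prob_space P \<Longrightarrow> prob_space (iid_sample P n)"
  unfolding iid_sample_def by (intro prob_space_PiM)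

lemma min_emp_risk_nonneg:
  assumes "\<And>f z. f \<in> F \<Longrightarrow> z \<in> space P \<Longrightarrow> 0 \<le> l f z"
    and "D \<in> space (iid_sample P n)"
  shows "0 \<le> min_emp_risk l n F D"
proof -
  have "D i \<in> space P" if "i \<in> {1..n}" for i
    using assms(2) that by (auto simp: iid_sample_def space_PiM PiE_iff)
  then have "0 \<le> emp_risk l n f D" if "f \<in> F" for f
    using assms(1) that unfolding emp_risk_def by (auto intro!: sum_nonneg divide_nonneg_nonneg)
  then show ?thesis
    unfolding min_emp_risk_def by (auto intro!: INF_greatest)
qed

lemma prob_min_emp_risk_eq_0_above_N_plus:
  assumes "n \<ge> 1" and "N_plus l F P < enat n"
  shows "measure (iid_sample P n) {D \<in> space (iid_sample P n). min_emp_risk l n F D = 0} = 0"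
proof (rule ccontr)
  assume "\<not> ?thesis"
  then have "measure (iid_sample P n) {D \<in> space (iid_sample P n). min_emp_risk l n F D = 0} > 0"
    by (simp add: zero_less_measure_iff)
  then have "enat n \<le> N_plus l F P"
    unfolding N_plus_def using assms(1) by (intro SUP_upper) simp
  with assms(2) show False by simp
qed

theorem corollary3:
  fixes \<alpha> :: real and n :: nat
    and F :: "'f set" and P :: "'z measure" and l :: "'f \<Rightarrow> 'z \<Rightarrow> real"
  assumes "0 < \<alpha>" and "\<alpha> < 1"
    and "n \<ge> 1"
    and "prob_space P"
    and loss_nonneg: "\<And>f z. f \<in> F \<Longrightarrow> z \<in> space P \<Longrightarrow> 0 \<le> l f z"
    and loss_measurable: "\<And>f. f \<in> F \<Longrightarrow> l f \<in> borel_measurable P"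
    and inf_measurable:
      "\<And>k. k \<ge> 1 \<Longrightarrow> min_emp_risk l k F \<in> borel_measurable (iid_sample P k)"
    and "N_plus l F P < enat n"
  shows "measure (iid_sample P n) {D \<in> space (iid_sample P n). L_ERM \<alpha> l n F D > 0} = 1"
proof -
  interpret prob_space "iid_sample P n"
    using \<open>prob_space P\<close> by (rule prob_space_iid_sample)
  let ?S = "space (iid_sample P n)"
  let ?Z = "{D \<in> ?S. min_emp_risk l n F D = 0}"
  have [measurable]: "min_emp_risk l n F \<in> borel_measurable (iid_sample P n)"
    using inf_measurable \<open>n \<ge> 1\<close> .
  have "L_ERM \<alpha> l n F D > 0 \<longleftrightarrow> min_emp_risk l n F D \<noteq> 0" if "D \<in> ?S" for D
  proof -
    have "0 \<le> min_emp_risk l n F D"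
      using loss_nonneg that by (rule min_emp_risk_nonneg)
    then show ?thesis
      using \<open>0 < \<alpha>\<close> unfolding L_ERM_def by (auto simp: ereal_zero_less_0_iff)
  qed
  then have "{D \<in> ?S. L_ERM \<alpha> l n F D > 0} = ?S - ?Z"
    by blast
  moreover have "prob (?S - ?Z) = 1 - prob ?Z"
    by (rule prob_compl) measurable
  moreover have "prob ?Z = 0"
    using prob_min_emp_risk_eq_0_above_N_plus \<open>n \<ge> 1\<close> \<open>N_plus l F P < enat n\<close> .
  ultimately show ?thesis by simp
qed

end
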